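(* There exists a non-hyponormal composition operator $C$ in an $L^2$-space over a $\sigma$-finite measure space which is injective, paranormal and which generates Stieltjes moment sequences. Moreover, $C$ has the property that $\mathcal{D}^\infty(C)$ is a core of $C^n$ for every $n\in\mathbb{Z}_+$.
   Context: $\mathbb{Z}_+=\{0,1,2,\ldots\}$, $\mathbb{R}_+=[0,\infty)$. All operators are linear, possibly unbounded, in complex Hilbert spaces; $\mathcal{D}(A)$ is the domain of $A$, $A^0=I$, and $\mathcal{D}^\infty(A)=\bigcap_{n=0}^\infty \mathcal{D}(A^n)$. Composition operator: given a measure space $(X,\Sigma,\mu)$ and a measurable map $\phi\colon X\to X$ (such that $f\mapsto f\circ\phi$ is well defined on $\mu$-equivalence classes), the composition operator $C$ in $L^2(\mu)$ is given by $\mathcal{D}(C)=\{f\in L^2(\mu)\colon f\circ\phi\in L^2(\mu)\}$ and $Cf=f\circ\phi$ for $f\in\mathcal{D}(C)$. A sequence $\{\gamma_n\}_{n=0}^\infty\subseteq\mathbb{R}$ is a Stieltjes moment sequence if there is a positive Borel measure $\mu$ on $\mathbb{R}_+$ with $\gamma_n=\int_0^\infty x^n\,d\mu(x)$ for all $n\in\mathbb{Z}_+$. An operator $S$ in a complex Hilbert space $\mathcal{H}$ generates Stieltjes moment sequences if $\mathcal{D}^\infty(S)$ is dense in $\mathcal{H}$ and $\{\|S^nf\|^2\}_{n=0}^\infty$ is a Stieltjes moment sequence for every $f\in\mathcal{D}^\infty(S)$. An operator $A$ is paranormal if $\|Af\|^2\le\|f\|\,\|A^2f\|$ for all $f\in\mathcal{D}(A^2)$.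 An operator $A$ is hyponormal if $A$ is densely defined, $\mathcal{D}(A)\subseteq\mathcal{D}(A^* )$ and $\|A^*f\|\le\|Af\|$ for all $f\in\mathcal{D}(A)$. A linear subspace $\mathcal{E}\subseteq\mathcal{D}(A)$ is a core of $A$ if the graph of $A$ is contained in the closure of the graph of $A|_{\mathcal{E}}$. *)

theory Defs
  imports "HOL-Analysis.Analysis"
begin

section \<open>Unbounded operators in complex inner product spaces\<close>

text \<open>
  HOL-Analysis has no complex inner product spaces, and the space \<open>L\<^sup>2(M)\<close> depends on a term
  \<open>M\<close>, so Hilbert spaces are carried by a record. The inner product is linear in its first
  argument. A (possibly unbounded) operator in \<open>H\<close> is a partial map whose domain \<open>dom A\<close> is
  contained in \<open>vecs H\<close>.
\<close>

record 'h hspace =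
  vecs :: "'h set"
  vadd :: "'h \<Rightarrow> 'h \<Rightarrow> 'h"
  vscale :: "complex \<Rightarrow> 'h \<Rightarrow> 'h"
  vinner :: "'h \<Rightarrow> 'h \<Rightarrow> complex"

definition vnorm :: "('h, 'm) hspace_scheme \<Rightarrow> 'h \<Rightarrow> real" where
  "vnorm H f = sqrt (Re (vinner H f f))"

definition vdist :: "('h, 'm) hspace_scheme \<Rightarrow> 'h \<Rightarrow> 'h \<Rightarrow> real" where
  "vdist H f g = vnorm H (vadd H f (vscale H (-1) g))"

definition linear_subspace :: "('h, 'm) hspace_scheme \<Rightarrow> 'h set \<Rightarrow> bool" where
  "linear_subspace H E \<longleftrightarrow> E \<subseteq> vecs H \<and> E \<noteq> {} \<and>
     (\<forall>f\<in>E. \<forall>g\<in>E. vadd H f g \<in> E) \<and> (\<forall>c. \<forall>f\<in>E. vscale H c f \<in> E)"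

definition dense_subset :: "('h, 'm) hspace_scheme \<Rightarrow> 'h set \<Rightarrow> bool" where
  "dense_subset H E \<longleftrightarrow> E \<subseteq> vecs H \<and> (\<forall>f\<in>vecs H. \<forall>e>0. \<exists>g\<in>E. vdist H f g < e)"

primrec op_power :: "('h, 'm) hspace_scheme \<Rightarrow> ('h \<rightharpoonup> 'h) \<Rightarrow> nat \<Rightarrow> ('h \<rightharpoonup> 'h)" where
  "op_power H A 0 = Some |` vecs H"
| "op_power H A (Suc n) = A \<circ>\<^sub>m op_power H A n"

definition dom_infty :: "('h, 'm) hspace_scheme \<Rightarrow> ('h \<rightharpoonup> 'h) \<Rightarrow> 'h set" where
  "dom_infty H A = (\<Inter>n. dom (op_power H A n))"

definition adjoint_pair :: "('h, 'm) hspace_scheme \<Rightarrow> ('h \<rightharpoonup> 'h) \<Rightarrow> 'h \<Rightarrow> 'h \<Rightarrow> bool" where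
  "adjoint_pair H A g h \<longleftrightarrow> g \<in> vecs H \<and> h \<in> vecs H \<and>
     (\<forall>f\<in>dom A. vinner H (the (A f)) g = vinner H f h)"

text \<open>The vector \<open>h\<close> below is unique when \<open>dom A\<close> is dense, the only case in which the adjoint
  is used.\<close>

definition op_adjoint :: "('h, 'm) hspace_scheme \<Rightarrow> ('h \<rightharpoonup> 'h) \<Rightarrow> ('h \<rightharpoonup> 'h)" where
  "op_adjoint H A g =
     (if \<exists>h. adjoint_pair H A g h then Some (THE h. adjoint_pair H A g h) else None)"

definition hyponormal :: "('h, 'm) hspace_scheme \<Rightarrow> ('h \<rightharpoonup> 'h) \<Rightarrow> bool" where
  "hyponormal H A \<longleftrightarrow> dense_subset H (dom A) \<and> dom A \<subseteq> dom (op_adjoint H A) \<and>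
     (\<forall>f\<in>dom A. vnorm H (the (op_adjoint H A f)) \<le> vnorm H (the (A f)))"

definition paranormal :: "('h, 'm) hspace_scheme \<Rightarrow> ('h \<rightharpoonup> 'h) \<Rightarrow> bool" where
  "paranormal H A \<longleftrightarrow> (\<forall>f\<in>dom (op_power H A 2).
     (vnorm H (the (A f)))\<^sup>2 \<le> vnorm H f * vnorm H (the (op_power H A 2 f)))"

definition stieltjes_moment_sequence :: "(nat \<Rightarrow> real) \<Rightarrow> bool" where
  "stieltjes_moment_sequence \<gamma> \<longleftrightarrow>
     (\<exists>\<nu>. sets \<nu> = sets (restrict_space borel {0::real..}) \<and>
          (\<forall>n. has_bochner_integral \<nu> (\<lambda>x. x ^ n) (\<gamma> n)))"

definition generates_stieltjes :: "('h, 'm) hspace_scheme \<Rightarrow> ('h \<rightharpoonup> 'h) \<Rightarrow> bool" where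
  "generates_stieltjes H S \<longleftrightarrow> dense_subset H (dom_infty H S) \<and>
     (\<forall>f\<in>dom_infty H S.
        stieltjes_moment_sequence (\<lambda>n. (vnorm H (the (op_power H S n f)))\<^sup>2))"

definition is_core :: "('h, 'm) hspace_scheme \<Rightarrow> 'h set \<Rightarrow> ('h \<rightharpoonup> 'h) \<Rightarrow> bool" where
  "is_core H E A \<longleftrightarrow> linear_subspace H E \<and> E \<subseteq> dom A \<and>
     (\<forall>(f, f') \<in> Map.graph A. \<forall>e>0. \<exists>(g, g') \<in> Map.graph (A |` E).
        vdist H f g < e \<and> vdist H f' g' < e)"


section \<open>The space \<open>L\<^sup>2(M)\<close> and its composition operators\<close>

definition sq_integrable :: "'a measure \<Rightarrow> ('a \<Rightarrow> complex) set" where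
  "sq_integrable M = {f \<in> borel_measurable M. integrable M (\<lambda>x. (cmod (f x))\<^sup>2)}"

definition ae_rel :: "'a measure \<Rightarrow> (('a \<Rightarrow> complex) \<times> ('a \<Rightarrow> complex)) set" where
  "ae_rel M = {(f, g). f \<in> sq_integrable M \<and> g \<in> sq_integrable M \<and> (AE x in M. f x = g x)}"

definition ae_class :: "'a measure \<Rightarrow> ('a \<Rightarrow> complex) \<Rightarrow> ('a \<Rightarrow> complex) set" where
  "ae_class M f = ae_rel M `` {f}"

definition rep :: "('a \<Rightarrow> complex) set \<Rightarrow> 'a \<Rightarrow> complex" where
  "rep F = (SOME f. f \<in> F)"

definition L2 :: "'a measure \<Rightarrow> ('a \<Rightarrow> complex) set hspace" where
  "L2 M = \<lparr> vecs = sq_integrable M // ae_rel M,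
            vadd = (\<lambda>F G. ae_class M (\<lambda>x. rep F x + rep G x)),
            vscale = (\<lambda>c F. ae_class M (\<lambda>x. c * rep F x)),
            vinner = (\<lambda>F G. \<integral>x. rep F x * cnj (rep G x) \<partial>M) \<rparr>"

text \<open>Composition with \<open>\<phi>\<close> is well defined on classes when preimages of null sets are null sets.\<close>

definition nonsingular :: "'a measure \<Rightarrow> ('a \<Rightarrow> 'a) \<Rightarrow> bool" where
  "nonsingular M \<phi> \<longleftrightarrow> \<phi> \<in> measurable M M \<and> absolutely_continuous M (distr M M \<phi>)"

definition composition_op ::
  "'a measure \<Rightarrow> ('a \<Rightarrow> 'a) \<Rightarrow> (('a \<Rightarrow> complex) set \<rightharpoonup> ('a \<Rightarrow> complex) set)" where
  "composition_op M \<phi> F =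
     (if F \<in> vecs (L2 M) \<and> rep F \<circ> \<phi> \<in> sq_integrable M
      then Some (ae_class M (rep F \<circ> \<phi>)) else None)"

lemma equiv_ae_rel: "equiv (sq_integrable M) (ae_rel M)"
proof (rule equivI)
  show "ae_rel M \<subseteq> sq_integrable M \<times> sq_integrable M"
    by (auto simp: ae_rel_def)
  show "refl_on (sq_integrable M) (ae_rel M)"
    by (auto simp: refl_on_def ae_rel_def)
  show "sym (ae_rel M)"
    by (rule symI) (auto simp: ae_rel_def elim: eventually_mono)
  show "trans (ae_rel M)"
  proof (rule transI)
    fix f g h assume *: "(f, g) \<in> ae_rel M" "(g, h) \<in> ae_rel M"
    then have "AE x in M. f x = g x" "AE x in M. g x = h x"
      by (auto simp: ae_rel_def)
    then have "AE x in M. f x = h x"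
      by eventually_elim simp
    with * show "(f, h) \<in> ae_rel M"
      by (auto simp: ae_rel_def)
  qed
qed

lemma ae_class_in_L2: "f \<in> sq_integrable M \<Longrightarrow> ae_class M f \<in> vecs (L2 M)"
  by (simp add: ae_class_def L2_def quotientI)

lemma rep_ae_class:
  assumes "f \<in> sq_integrable M"
  shows "rep (ae_class M f) \<in> sq_integrable M" "AE x in M. rep (ae_class M f) x = f x"
proof -
  have "f \<in> ae_class M f"
    using assms by (simp add: ae_class_def ae_rel_def)
  then have "rep (ae_class M f) \<in> ae_class M f"
    unfolding rep_def[of "ae_class M f"] by (rule someI[of "\<lambda>g. g \<in> ae_class M f"])
  then have *: "rep (ae_class M f) \<in> sq_integrable M" "AE x in M. f x = rep (ae_class M f) x"
    by (auto simp: ae_class_def ae_rel_def)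
  show "rep (ae_class M f) \<in> sq_integrable M"
    by (rule *(1))
  show "AE x in M. rep (ae_class M f) x = f x"
    using *(2) by eventually_elim simp
qed

lemma vinner_ae_class:
  assumes "f \<in> sq_integrable M" "g \<in> sq_integrable M"
  shows "vinner (L2 M) (ae_class M f) (ae_class M g) = (\<integral>x. f x * cnj (g x) \<partial>M)"
proof -
  have [measurable]: "f \<in> borel_measurable M" "g \<in> borel_measurable M"
    "rep (ae_class M f) \<in> borel_measurable M" "rep (ae_class M g) \<in> borel_measurable M"
    using assms rep_ae_class(1)[OF assms(1)] rep_ae_class(1)[OF assms(2)]
    by (auto simp: sq_integrable_def)
  have cnj[measurable]: "cnj \<in> borel_measurable borel"
    by (intro borel_measurable_continuous_onI continuous_intros)
  have "AE x in M. rep (ae_class M f) x * cnj (rep (ae_class M g) x) = f x * cnj (g x)"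
    using rep_ae_class(2)[OF assms(1)] rep_ae_class(2)[OF assms(2)]
    by eventually_elim simp
  then show ?thesis
    unfolding L2_def by simp (rule integral_cong_AE; measurable)
qed

lemma composition_op_ae_class:
  assumes ns: "nonsingular M \<phi>" and f: "f \<in> sq_integrable M"
  shows "composition_op M \<phi> (ae_class M f) =
    (if f \<circ> \<phi> \<in> sq_integrable M then Some (ae_class M (f \<circ> \<phi>)) else None)"
proof -
  define g where "g = rep (ae_class M f)"
  have [measurable]: "\<phi> \<in> measurable M M"
    using ns by (simp add: nonsingular_def)
  have [measurable]: "f \<in> borel_measurable M" "g \<in> borel_measurable M"
    using f rep_ae_class(1)[OF f] by (auto simp: sq_integrable_def g_def)
  have "AE x in M. g x = f x"
    unfolding g_def by (rule rep_ae_class(2)[OF f])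
  then have "AE x in distr M M \<phi>. g x = f x"
    using ns by (intro absolutely_continuous_AE[of "distr M M \<phi>" M])
      (auto simp: nonsingular_def)
  then have ae: "AE x in M. (g \<circ> \<phi>) x = (f \<circ> \<phi>) x"
    by (simp add: AE_distr_iff)
  have "integrable M (\<lambda>x. (cmod ((g \<circ> \<phi>) x))\<^sup>2) = integrable M (\<lambda>x. (cmod ((f \<circ> \<phi>) x))\<^sup>2)"
    by (intro integrable_cong_AE) (use ae in \<open>auto elim!: eventually_mono\<close>)
  then have iff: "g \<circ> \<phi> \<in> sq_integrable M \<longleftrightarrow> f \<circ> \<phi> \<in> sq_integrable M"
    by (simp add: sq_integrable_def)
  have "ae_class M (g \<circ> \<phi>) = ae_class M (f \<circ> \<phi>)" if "f \<circ> \<phi> \<in> sq_integrable M"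
    unfolding ae_class_def using that iff ae
    by (intro equiv_class_eq[OF equiv_ae_rel]) (simp add: ae_rel_def)
  then show ?thesis
    using ae_class_in_L2[OF f] iff by (auto simp: composition_op_def g_def)
qed

end

theory Submission
  imports Defs
begin

text \<open>
  On a countable set, \<open>\<parallel>C\<^sup>n f\<parallel>\<^sup>2\<close> is the weighted sum of \<open>\<bar>f x\<bar>\<^sup>2 W n x\<close>, where \<open>W n x\<close> is the mass of
  the \<open>n\<close>-fold preimage of \<open>x\<close>. If every \<open>W n x\<close> is a finite Stieltjes moment in \<open>n\<close>, so is
  \<open>\<parallel>C\<^sup>n f\<parallel>\<^sup>2\<close>; paranormality follows, and finitely supported functions form a core of all powers.
  Hyponormality would force the sum of \<open>(W 0 y)\<^sup>2 / W 1 y\<close> over the preimages \<open>y\<close> of \<open>x\<close> to be at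
  most \<open>W 0 x\<close>.

  This fails on a tree with one branching vertex when the branches and the trunk use two different
  measures with the same moments of order \<open>m \<ge> 1\<close>. They come from the entire function
  \<open>E z = (\<Sum>n. c n * z ^ n)\<close> with \<open>c n = (\<Prod>k=1..n. 1 / (2 ^ k - 1))\<close>: since
  \<open>E (2 * z) = (1 + z) * E z\<close>, it vanishes at \<open>- (2 ^ m)\<close> for \<open>m \<ge> 1\<close>, so the parts of
  \<open>\<Sum>n. c n * (2 ^ n) ^ m\<close> with even and odd \<open>n\<close> agree for those \<open>m\<close>, whereas for \<open>m = 0\<close> the
  even part is larger.
\<close>

section \<open>Square-integrable functions\<close>

lemma sq_integrable_add:
  assumes "f \<in> sq_integrable M" "g \<in> sq_integrable M"
  shows "(\<lambda>x. f x + g x) \<in> sq_integrable M"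
proof -
  have [measurable]: "f \<in> borel_measurable M" "g \<in> borel_measurable M"
    using assms by (auto simp: sq_integrable_def)
  have "(cmod (f x + g x))\<^sup>2 \<le> 2 * (cmod (f x))\<^sup>2 + 2 * (cmod (g x))\<^sup>2" for x
  proof -
    have "(cmod (f x + g x))\<^sup>2 \<le> (cmod (f x) + cmod (g x))\<^sup>2"
      by (intro power_mono norm_triangle_ineq) simp
    also have "\<dots> \<le> 2 * (cmod (f x))\<^sup>2 + 2 * (cmod (g x))\<^sup>2"
      using sum_squares_bound[of "cmod (f x)" "cmod (g x)"] by (simp add: power2_sum)
    finally show ?thesis .
  qed
  moreover have "integrable M (\<lambda>x. 2 * (cmod (f x))\<^sup>2 + 2 * (cmod (g x))\<^sup>2)"
    using assms by (auto simp: sq_integrable_def)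
  ultimately have "integrable M (\<lambda>x. (cmod (f x + g x))\<^sup>2)"
    by (elim Bochner_Integration.integrable_bound) auto
  then show ?thesis
    by (simp add: sq_integrable_def)
qed

lemma sq_integrable_mult:
  "f \<in> sq_integrable M \<Longrightarrow> (\<lambda>x. c * f x) \<in> sq_integrable M"
  by (auto simp: sq_integrable_def norm_mult power_mult_distrib)

lemma L2_cases:
  assumes "F \<in> vecs (L2 M)"
  obtains f where "f \<in> sq_integrable M" "F = ae_class M f"
  using assms by (auto simp: L2_def ae_class_def elim!: quotientE)

lemma vnorm_ae_class:
  assumes "f \<in> sq_integrable M"
  shows "(vnorm (L2 M) (ae_class M f))\<^sup>2 = (\<integral>x. (cmod (f x))\<^sup>2 \<partial>M)"
proof -
  have "vinner (L2 M) (ae_class M f) (ae_class M f) = (\<integral>x. complex_of_real ((cmod (f x))\<^sup>2) \<partial>M)"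
    using vinner_ae_class[OF assms assms] by (simp only: complex_norm_square)
  then show ?thesis
    by (simp add: vnorm_def del: of_real_power)
qed

lemma vnorm_nonneg: "0 \<le> vnorm (L2 M) F"
  by (simp add: vnorm_def L2_def flip: complex_norm_square of_real_power)

text \<open>The quadratic \<open>l\<^sup>2 * a - 2 * l * b + d\<close> is nonnegative, so its value
  at the minimum \<open>l = b / a\<close> gives the bound. For \<open>a = 0\<close> it is linear and
  bounded below, which forces \<open>b = 0\<close>.\<close>

lemma discriminant:
  fixes a b d :: real
  assumes "\<And>l. 2 * l * b \<le> l\<^sup>2 * a + d" "0 \<le> a"
  shows "b\<^sup>2 \<le> a * d"
proof (cases "a = 0")
  case True
  have "b = 0"
  proof (rule ccontr)
    assume "b \<noteq> 0"
    \<comment> \<open>This choice turns the hypothesis into \<open>d + 1 \<le> d\<close>.\<close>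
    with assms(1)[of "(d + 1) / (2 * b)"] True show False
      by simp
  qed
  then show ?thesis
    using True by simp
next
  case False
  with assms(1)[of "b / a"] assms(2) show ?thesis
    by (simp add: field_simps power2_eq_square)
qed

section \<open>Composition operators on weighted countable sets\<close>

text \<open>\<open>W n x\<close> is the mass of the \<open>n\<close>-fold preimage of \<open>{x}\<close>, and \<open>W_sums\<close> makes it the \<open>n\<close>-th moment
  of the measure with atoms \<open>P x k\<close> at \<open>t k\<close>.\<close>

locale discrete_composition =
  fixes S :: "'a set" and \<phi> :: "'a \<Rightarrow> 'a" and t :: "nat \<Rightarrow> real" and P :: "'a \<Rightarrow> nat \<Rightarrow> real"
    and W :: "nat \<Rightarrow> 'a \<Rightarrow> real"
  assumes countable: "countable S"
    and image: "\<phi> ` S = S"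
    and t_nonneg: "0 \<le> t k"
    and P_nonneg: "0 \<le> P x k"
    and W_sums: "x \<in> S \<Longrightarrow> (\<lambda>k. P x k * t k ^ n) sums W n x"
    and W_pos: "x \<in> S \<Longrightarrow> 0 < W 0 x"
    and W_fibre: "x \<in> S \<Longrightarrow>
      (\<integral>\<^sup>+y. ennreal (W n y) \<partial>count_space {y\<in>S. \<phi> y = x}) = ennreal (W (Suc n) x)"
begin

text \<open>The image of \<open>M\<close> under \<open>\<phi> ^^ n\<close> (see
  \<open>distr_funpow\<close>), so that \<open>\<parallel>C\<^sup>n f\<parallel>\<^sup>2\<close> is
  the integral of \<open>(cmod (f x))\<^sup>2\<close> against it.\<close>

definition mass :: "nat \<Rightarrow> 'a measure" where
  "mass n = point_measure S (\<lambda>x. ennreal (W n x))"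

abbreviation "M \<equiv> mass 0"

abbreviation "H \<equiv> L2 M"

abbreviation "C \<equiv> composition_op M \<phi>"

lemma W_nonneg: "x \<in> S \<Longrightarrow> 0 \<le> W n x"
  by (rule sums_le[OF _ sums_zero W_sums]) (simp_all add: P_nonneg t_nonneg)

lemma space_mass [simp]: "space (mass n) = S"
  by (simp add: mass_def space_point_measure)

lemma sets_mass [measurable_cong, simp]: "sets (mass n) = sets (count_space S)"
  by (simp add: mass_def sets_point_measure)

lemma measurable_mass: "f \<in> borel_measurable (mass n)"
  using measurable_cong_sets[OF sets_mass refl, of n borel] by auto

lemma maps_to: "x \<in> S \<Longrightarrow> \<phi> x \<in> S"
  using image by blast

lemma funpow_maps_to: "x \<in> S \<Longrightarrow> (\<phi> ^^ n) x \<in> S"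
  by (induction n) (auto intro: maps_to)

lemma funpow_measurable: "\<phi> ^^ n \<in> measurable (mass m) (mass k)"
  using measurable_cong_sets[OF sets_mass sets_mass, of m k] by (auto intro: funpow_maps_to)

lemma map_measurable: "\<phi> \<in> measurable (mass m) (mass k)"
  using funpow_measurable[of 1] by simp

text \<open>Every point of \<open>S\<close> has positive mass, so only the empty set is null and
  equivalence classes amount to functions on \<open>S\<close>.\<close>

lemma AE_mass: "(AE x in M. Q x) \<longleftrightarrow> (\<forall>x\<in>S. Q x)"
  unfolding mass_def AE_point_measure using W_pos by auto

lemma sigma_finite: "sigma_finite_measure M"
  unfolding mass_def point_measure_def using countable
  by (subst sigma_finite_measure.sigma_finite_iff_density_finite
      [OF sigma_finite_measure_count_space_countable]) auto

lemma nonsingular: "nonsingular M \<phi>"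
proof -
  have "N = {}" if "N \<in> null_sets M" for N
  proof -
    have "N \<subseteq> S" "AE x in M. x \<notin> N"
      using sets.sets_into_space[OF null_setsD2[OF that]] AE_not_in[OF that] by simp_all
    then show ?thesis
      by (auto simp: AE_mass)
  qed
  then show ?thesis
    using map_measurable by (auto simp: nonsingular_def absolutely_continuous_def)
qed

lemma emeasure_mass:
  "A \<subseteq> S \<Longrightarrow> emeasure (mass n) A = (\<integral>\<^sup>+x. ennreal (W n x) \<partial>count_space A)"
  by (auto simp: mass_def point_measure_def emeasure_density nn_integral_count_space_indicator
      intro!: nn_integral_cong split: split_indicator)

text \<open>Measures on a countable set are determined by singletons, where the claim is
  \<open>W_fibre\<close>.\<close>

lemma distr_mass: "distr (mass n) M \<phi> = mass (Suc n)"
proof (rule measure_eqI_countable[of _ S])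
  fix x assume x: "x \<in> S"
  have "emeasure (distr (mass n) M \<phi>) {x} = emeasure (mass n) {y\<in>S. \<phi> y = x}"
    using x by (subst emeasure_distr) (auto intro!: map_measurable arg_cong[where f="emeasure _"])
  also have "\<dots> = ennreal (W (Suc n) x)"
    using x by (simp add: emeasure_mass W_fibre)
  also have "\<dots> = emeasure (mass (Suc n)) {x}"
    using x by (simp add: emeasure_mass nn_integral_count_space_finite)
  finally show "emeasure (distr (mass n) M \<phi>) {x} = emeasure (mass (Suc n)) {x}" .
qed (auto simp: countable)

lemma distr_funpow: "distr M M (\<phi> ^^ n) = mass n"
proof (induction n)
  case 0
  show ?case
    using distr_id[of M] by (simp add: id_def)
next
  case (Suc n)
  have "distr M M (\<phi> ^^ Suc n) = distr (distr M M (\<phi> ^^ n)) M \<phi>"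
    by (simp add: distr_distr[OF map_measurable funpow_measurable] comp_def)
  then show ?case
    by (simp only: Suc.IH distr_mass)
qed

lemma sq_integrable_funpow_iff:
  "f \<circ> \<phi> ^^ n \<in> sq_integrable M \<longleftrightarrow> integrable (mass n) (\<lambda>x. (cmod (f x))\<^sup>2)"
  unfolding distr_funpow[of n, symmetric]
  by (simp add: sq_integrable_def measurable_mass integrable_distr_eq[OF funpow_measurable])

lemma integral_funpow:
  fixes f :: "'a \<Rightarrow> 'b::{banach, second_countable_topology}"
  shows "(\<integral>x. f ((\<phi> ^^ n) x) \<partial>M) = (\<integral>x. f x \<partial>mass n)"
  by (subst distr_funpow[of n, symmetric])
     (simp add: integral_distr[OF funpow_measurable measurable_mass])

text \<open>Every \<open>W n x\<close> is finite, so finitely supported functions are integrable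
  against all \<open>mass n\<close> at once; this puts them in \<open>dom_infty H C\<close>.\<close>

lemma integral_finite_support:
  fixes f :: "'a \<Rightarrow> 'b::{banach, second_countable_topology}"
  assumes "finite A" "A \<subseteq> S" "\<And>x. x \<in> S - A \<Longrightarrow> f x = 0"
  shows "integrable (mass n) f" "(\<integral>x. f x \<partial>mass n) = (\<Sum>x\<in>A. W n x *\<^sub>R f x)"
proof -
  have ae: "AE x in count_space S. 0 \<le> W n x"
    by (auto simp: AE_count_space W_nonneg)
  have "integrable (count_space S) (\<lambda>x. W n x *\<^sub>R f x)"
  proof (rule integrableI_bounded)
    have "(\<integral>\<^sup>+x. norm (W n x *\<^sub>R f x) \<partial>count_space S) = (\<Sum>x\<in>A. ennreal (norm (W n x *\<^sub>R f x)))"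
      using assms by (intro nn_integral_count_space') auto
    then show "(\<integral>\<^sup>+x. norm (W n x *\<^sub>R f x) \<partial>count_space S) < \<infinity>"
      by simp
  qed auto
  then show "integrable (mass n) f"
    by (simp add: mass_def point_measure_def integrable_density ae)
  have "(\<integral>x. f x \<partial>mass n) = (\<integral>x. W n x *\<^sub>R f x \<partial>count_space S)"
    by (simp add: mass_def point_measure_def integral_density ae)
  also have "\<dots> = (\<Sum>x | x \<in> S \<and> W n x *\<^sub>R f x \<noteq> 0. W n x *\<^sub>R f x)"
    using assms by (intro lebesgue_integral_count_space_finite_support finite_subset[OF _ assms(1)]) auto
  also have "\<dots> = (\<Sum>x\<in>A. W n x *\<^sub>R f x)"
    using assms by (intro sum.mono_neutral_left) auto
  finally show "(\<integral>x. f x \<partial>mass n) = (\<Sum>x\<in>A. W n x *\<^sub>R f x)" .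
qed

section \<open>Vectors as functions on \<open>S\<close>, and the powers of \<open>C\<close>\<close>

lemma ae_class_eq_iff:
  assumes "f \<in> sq_integrable M" "g \<in> sq_integrable M"
  shows "ae_class M f = ae_class M g \<longleftrightarrow> (\<forall>x\<in>S. f x = g x)"
  unfolding ae_class_def using eq_equiv_class_iff[OF equiv_ae_rel assms] assms
  by (simp add: ae_rel_def AE_mass)

lemma rep_eq: "f \<in> sq_integrable M \<Longrightarrow> x \<in> S \<Longrightarrow> rep (ae_class M f) x = f x"
  using rep_ae_class(2)[of f M] by (simp add: AE_mass)

lemma vadd_ae_class:
  assumes "f \<in> sq_integrable M" "g \<in> sq_integrable M"
  shows "vadd H (ae_class M f) (ae_class M g) = ae_class M (\<lambda>x. f x + g x)"
  using assms rep_ae_class(1)[OF assms(1)] rep_ae_class(1)[OF assms(2)]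
  by (simp add: L2_def ae_class_eq_iff sq_integrable_add rep_eq)

lemma vscale_ae_class:
  assumes "f \<in> sq_integrable M"
  shows "vscale H c (ae_class M f) = ae_class M (\<lambda>x. c * f x)"
  using assms rep_ae_class(1)[OF assms]
  by (simp add: L2_def ae_class_eq_iff sq_integrable_mult rep_eq)

lemma vdist_ae_class:
  assumes "f \<in> sq_integrable M" "g \<in> sq_integrable M"
  shows "(vdist H (ae_class M f) (ae_class M g))\<^sup>2 = (\<integral>x. (cmod (f x - g x))\<^sup>2 \<partial>M)"
proof -
  have "(\<lambda>x. - g x) \<in> sq_integrable M"
    using sq_integrable_mult[OF assms(2), of "-1"] by simp
  then show ?thesis
    using assms vnorm_ae_class[OF sq_integrable_add[OF assms(1), of "\<lambda>x. - g x"]]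
    by (simp add: vdist_def vscale_ae_class vadd_ae_class)
qed

text \<open>The domain of \<open>C\<^sup>n\<close> asks every intermediate image to be
  square-integrable, hence the condition for all \<open>m \<le> n\<close>.\<close>

lemma op_power_ae_class:
  assumes "f \<in> sq_integrable M"
  shows "op_power H C n (ae_class M f) =
    (if \<forall>m\<le>n. integrable (mass m) (\<lambda>x. (cmod (f x))\<^sup>2)
     then Some (ae_class M (f \<circ> \<phi> ^^ n)) else None)"
proof (induction n)
  case 0
  then show ?case
    using assms ae_class_in_L2[OF assms] by (auto simp: sq_integrable_def)
next
  case (Suc n)
  show ?case
  proof (cases "\<forall>m\<le>n. integrable (mass m) (\<lambda>x. (cmod (f x))\<^sup>2)")
    case True
    then have "f \<circ> \<phi> ^^ n \<in> sq_integrable M"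
      by (simp add: sq_integrable_funpow_iff)
    \<comment> \<open>\<open>C\<close> inserts the new \<open>\<phi>\<close> on the inside, whereas
      \<open>funpow\<close> unfolds on the outside.\<close>
    moreover have "f \<circ> \<phi> ^^ n \<circ> \<phi> = f \<circ> \<phi> ^^ Suc n"
      by (simp only: funpow_Suc_right comp_assoc)
    ultimately show ?thesis
      using Suc True
      by (simp add: map_comp_def composition_op_ae_class[OF nonsingular]
          sq_integrable_funpow_iff le_Suc_eq del: funpow.simps)
  next
    case False
    then show ?thesis
      using Suc by (auto simp: map_comp_def)
  qed
qed

lemma dom_op_power_iff:
  "f \<in> sq_integrable M \<Longrightarrow> ae_class M f \<in> dom (op_power H C n) \<longleftrightarrow>
    (\<forall>m\<le>n. integrable (mass m) (\<lambda>x. (cmod (f x))\<^sup>2))"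
  by (auto simp: op_power_ae_class dom_def)

lemma dom_op_power_vecs: "dom (op_power H C n) \<subseteq> vecs H"
proof (induction n)
  case (Suc n)
  then show ?case
    by (auto simp: map_comp_def split: option.splits)
qed (auto simp: restrict_map_def dom_def split: if_splits)

lemma dom_infty_vecs: "dom_infty H C \<subseteq> vecs H"
  using dom_op_power_vecs[of 0] unfolding dom_infty_def by blast

lemma dom_infty_iff:
  "f \<in> sq_integrable M \<Longrightarrow> ae_class M f \<in> dom_infty H C \<longleftrightarrow>
    (\<forall>m. integrable (mass m) (\<lambda>x. (cmod (f x))\<^sup>2))"
  by (auto simp: dom_infty_def dom_op_power_iff)

lemma vnorm_op_power:
  assumes "f \<in> sq_integrable M" "ae_class M f \<in> dom (op_power H C n)"
  shows "(vnorm H (the (op_power H C n (ae_class M f))))\<^sup>2 = (\<integral>x. (cmod (f x))\<^sup>2 \<partial>mass n)"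
proof -
  have *: "\<forall>m\<le>n. integrable (mass m) (\<lambda>x. (cmod (f x))\<^sup>2)"
    using assms by (simp add: dom_op_power_iff)
  then have "f \<circ> \<phi> ^^ n \<in> sq_integrable M"
    by (simp add: sq_integrable_funpow_iff)
  then show ?thesis
    using assms * by (simp add: op_power_ae_class vnorm_ae_class
        integral_funpow[of "\<lambda>x. (cmod (f x))\<^sup>2"])
qed

lemma op_power_one: "op_power H C 1 F = C F"
  by (auto simp: map_comp_def restrict_map_def composition_op_def)

lemma dom_infty_dom: "F \<in> dom_infty H C \<Longrightarrow> F \<in> dom (op_power H C n)"
  unfolding dom_infty_def by blast

lemma dom_infty_dom_op: "F \<in> dom_infty H C \<Longrightarrow> F \<in> dom C"
  using dom_infty_dom[of F 1] by (simp only: domIff op_power_one simp_thms)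

section \<open>Finitely supported functions, cores and density\<close>

lemma finite_support_in_dom_infty:
  assumes "finite A" "A \<subseteq> S" "\<And>x. x \<in> S - A \<Longrightarrow> f x = 0"
  shows "f \<in> sq_integrable M" "ae_class M f \<in> dom_infty H C"
proof -
  have *: "integrable (mass n) (\<lambda>x. (cmod (f x))\<^sup>2)" for n
    using assms by (intro integral_finite_support) auto
  then show "f \<in> sq_integrable M"
    by (simp add: sq_integrable_def measurable_mass)
  with * show "ae_class M f \<in> dom_infty H C"
    by (simp add: dom_infty_iff)
qed

lemma linear_subspace_dom_infty: "linear_subspace H (dom_infty H C)"
  unfolding linear_subspace_def
proof (intro conjI ballI allI)
  show "dom_infty H C \<subseteq> vecs H"
    by (rule dom_infty_vecs)
  show "dom_infty H C \<noteq> {}"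
    using finite_support_in_dom_infty(2)[of "{}" "\<lambda>_. 0"] by auto
next
  fix F G assume FG: "F \<in> dom_infty H C" "G \<in> dom_infty H C"
  obtain f where f: "f \<in> sq_integrable M" "F = ae_class M f"
    using FG(1) dom_infty_vecs by (blast elim: L2_cases)
  obtain g where g: "g \<in> sq_integrable M" "G = ae_class M g"
    using FG(2) dom_infty_vecs by (blast elim: L2_cases)
  have "(\<lambda>x. f x + g x) \<in> sq_integrable (mass m)" for m
    using FG f g by (intro sq_integrable_add) (auto simp: sq_integrable_def measurable_mass dom_infty_iff)
  then show "vadd H F G \<in> dom_infty H C"
    using f g by (simp add: vadd_ae_class dom_infty_iff sq_integrable_add sq_integrable_def)
next
  fix F and c :: complex assume F: "F \<in> dom_infty H C"
  obtain f where f: "f \<in> sq_integrable M" "F = ae_class M f"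
    using F dom_infty_vecs by (blast elim: L2_cases)
  have "(\<lambda>x. c * f x) \<in> sq_integrable (mass m)" for m
    using F f by (intro sq_integrable_mult) (auto simp: sq_integrable_def measurable_mass dom_infty_iff)
  then show "vscale H c F \<in> dom_infty H C"
    using f by (simp add: vscale_ae_class dom_infty_iff sq_integrable_mult sq_integrable_def)
qed

text \<open>The error vanishes eventually at each point and is dominated by
  \<open>(cmod (f x))\<^sup>2\<close>. As \<open>to_nat_on S\<close> enumerates \<open>S\<close>,
  each truncation has finite support in \<open>S\<close>.\<close>

lemma truncation_tendsto:
  fixes f :: "'a \<Rightarrow> complex"
  assumes "integrable (mass n) (\<lambda>x. (cmod (f x))\<^sup>2)"
  shows "(\<lambda>N. \<integral>x. (cmod (f x - (if to_nat_on S x < N then f x else 0)))\<^sup>2 \<partial>mass n) \<longlonglongrightarrow> 0"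
proof -
  have "(\<lambda>N. \<integral>x. (cmod (f x - (if to_nat_on S x < N then f x else 0)))\<^sup>2 \<partial>mass n)
      \<longlonglongrightarrow> (\<integral>x. 0 \<partial>mass n)"
  proof (rule integral_dominated_convergence[where w = "\<lambda>x. (cmod (f x))\<^sup>2"])
    show "AE x in mass n. (\<lambda>N. (cmod (f x - (if to_nat_on S x < N then f x else 0)))\<^sup>2) \<longlonglongrightarrow> 0"
    proof (rule AE_I2)
      fix x
      show "(\<lambda>N. (cmod (f x - (if to_nat_on S x < N then f x else 0)))\<^sup>2) \<longlonglongrightarrow> 0"
        by (rule tendsto_eventually, rule eventually_mono[OF eventually_gt_at_top[of "to_nat_on S x"]])
           simp
    qed
  qed (auto simp: assms measurable_mass)
  then show ?thesis
    by simp
qed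

text \<open>Approximating in the graph of \<open>C\<^sup>n\<close> means making the squared error
  small against both \<open>mass 0\<close> and \<open>mass n\<close>; one truncation does
  both.\<close>

lemma is_core_dom_infty: "is_core H (dom_infty H C) (op_power H C n)"
  unfolding is_core_def
proof (intro conjI ballI allI impI linear_subspace_dom_infty)
  show "dom_infty H C \<subseteq> dom (op_power H C n)"
    by (auto simp: dom_infty_def)
next
  fix u assume u: "u \<in> Map.graph (op_power H C n)"
  obtain F F' where FF': "u = (F, F')" "op_power H C n F = Some F'"
    using u by (cases u) (auto simp: Map.graph_def)
  then have "F \<in> vecs H"
    using dom_op_power_vecs by blast
  then obtain f where f: "f \<in> sq_integrable M" "F = ae_class M f"
    by (elim L2_cases)
  have F_dom: "F \<in> dom (op_power H C n)"
    using FF' by blast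
  then have f_int: "\<forall>m\<le>n. integrable (mass m) (\<lambda>x. (cmod (f x))\<^sup>2)"
    using f by (simp add: dom_op_power_iff)
  then have f_n: "f \<circ> \<phi> ^^ n \<in> sq_integrable M"
    by (simp add: sq_integrable_funpow_iff)
  have F': "F' = ae_class M (f \<circ> \<phi> ^^ n)"
    using FF' f f_int by (simp add: op_power_ae_class)
  show "case u of (f, f') \<Rightarrow> \<forall>e>0. \<exists>(g, g')\<in>Map.graph (op_power H C n |` dom_infty H C).
      vdist H f g < e \<and> vdist H f' g' < e"
    unfolding FF'(1) prod.case
  proof (intro allI impI)
    fix e :: real assume e: "e > 0"
    define g where "g N x = (if to_nat_on S x < N then f x else 0)" for N x
    have "(\<lambda>N. \<integral>x. (cmod (f x - g N x))\<^sup>2 \<partial>mass m) \<longlonglongrightarrow> 0" if "m \<le> n" for m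
      unfolding g_def using f_int that by (intro truncation_tendsto) auto
    then have ev: "\<forall>\<^sub>F N in sequentially. (\<integral>x. (cmod (f x - g N x))\<^sup>2 \<partial>mass m) < e\<^sup>2" if "m \<le> n" for m
      using e that by (intro order_tendstoD(2)[of _ 0]) auto
    have "\<forall>\<^sub>F N in sequentially. (\<integral>x. (cmod (f x - g N x))\<^sup>2 \<partial>mass 0) < e\<^sup>2 \<and>
        (\<integral>x. (cmod (f x - g N x))\<^sup>2 \<partial>mass n) < e\<^sup>2"
      using ev[of 0] ev[of n] by (auto intro: eventually_conj)
    then obtain N where N: "(\<integral>x. (cmod (f x - g N x))\<^sup>2 \<partial>M) < e\<^sup>2"
        "(\<integral>x. (cmod (f x - g N x))\<^sup>2 \<partial>mass n) < e\<^sup>2"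
      using eventually_happens'[OF sequentially_bot] by blast
    define A where "A = {x\<in>S. to_nat_on S x < N}"
    have "finite A"
    proof (rule finite_imageD)
      show "finite (to_nat_on S ` A)"
        by (rule finite_subset[of _ "{..<N}"]) (auto simp: A_def)
      show "inj_on (to_nat_on S) A"
        using inj_on_to_nat_on[OF countable] by (rule inj_on_subset) (auto simp: A_def)
    qed
    then have g: "g N \<in> sq_integrable M" "ae_class M (g N) \<in> dom_infty H C"
      using finite_support_in_dom_infty[of A "g N"] by (auto simp: A_def g_def)
    have g_int: "\<forall>m. integrable (mass m) (\<lambda>x. (cmod (g N x))\<^sup>2)"
      using g by (simp add: dom_infty_iff)
    then have g_n: "g N \<circ> \<phi> ^^ n \<in> sq_integrable M"
      by (simp add: sq_integrable_funpow_iff)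
    have "(ae_class M (g N), ae_class M (g N \<circ> \<phi> ^^ n)) \<in> Map.graph (op_power H C n |` dom_infty H C)"
      using g g_int by (simp add: Map.graph_def op_power_ae_class)
    moreover have "vdist H F (ae_class M (g N)) < e"
      using N(1) f g e
      by (intro power2_less_imp_less[of _ e]) (simp_all add: vdist_ae_class)
    moreover have "vdist H F' (ae_class M (g N \<circ> \<phi> ^^ n)) < e"
      using N(2) f_n g_n e
      by (intro power2_less_imp_less[of _ e])
         (simp_all add: vdist_ae_class F' integral_funpow[of "\<lambda>x. (cmod (f x - g N x))\<^sup>2"])
    ultimately show "\<exists>(g, g')\<in>Map.graph (op_power H C n |` dom_infty H C).
        vdist H F g < e \<and> vdist H F' g' < e"
      by blast
  qed
qed

lemma dense_dom_infty: "dense_subset H (dom_infty H C)"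
  unfolding dense_subset_def
proof (intro conjI ballI allI impI dom_infty_vecs)
  fix F and e :: real assume "F \<in> vecs H" "e > 0"
  \<comment> \<open>\<open>C\<^sup>0\<close> is the identity on \<open>vecs H\<close>, so its core
    property is density.\<close>
  then have "(F, F) \<in> Map.graph (op_power H C 0)"
    by (simp add: Map.graph_def)
  then show "\<exists>G\<in>dom_infty H C. vdist H F G < e"
    using is_core_dom_infty[of 0] \<open>e > 0\<close> unfolding is_core_def
    by (fastforce simp: Map.graph_def restrict_map_def split: if_splits)
qed

text \<open>\<open>\<phi>\<close> maps \<open>S\<close> onto \<open>S\<close>, so
  \<open>f \<circ> \<phi>\<close> determines \<open>f\<close> at every point.\<close>

lemma injective: "inj_on C (dom C)"
proof (rule inj_onI)
  fix F G assume FG: "F \<in> dom C" "G \<in> dom C" "C F = C G"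
  obtain f where f: "f \<in> sq_integrable M" "F = ae_class M f"
    using FG(1) by (auto simp: composition_op_def split: if_splits elim!: L2_cases)
  obtain g where g: "g \<in> sq_integrable M" "G = ae_class M g"
    using FG(2) by (auto simp: composition_op_def split: if_splits elim!: L2_cases)
  have fg: "f \<circ> \<phi> \<in> sq_integrable M" "g \<circ> \<phi> \<in> sq_integrable M"
    using FG f g by (auto simp: composition_op_ae_class[OF nonsingular] split: if_splits)
  then have "f (\<phi> x) = g (\<phi> x)" if "x \<in> S" for x
    using FG(3) f g that by (simp add: composition_op_ae_class[OF nonsingular] ae_class_eq_iff)
  then have "\<forall>x\<in>S. f x = g x"
    using image by (metis imageE)
  then show "F = G"
    using f g by (simp add: ae_class_eq_iff)
qed

section \<open>Paranormality\<close>

lemma W_quadratic: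
  assumes "x \<in> S"
  shows "2 * l * W 1 x \<le> l\<^sup>2 * W 0 x + W 2 x"
proof (rule sums_le)
  show "(\<lambda>k. 2 * l * (P x k * t k ^ 1)) sums (2 * l * W 1 x)"
    by (intro sums_mult W_sums assms)
  show "(\<lambda>k. l\<^sup>2 * (P x k * t k ^ 0) + P x k * t k ^ 2) sums (l\<^sup>2 * W 0 x + W 2 x)"
    by (intro sums_add sums_mult W_sums assms)
  fix k
  \<comment> \<open>Summed over the atoms, this square is
    \<open>l\<^sup>2 * W 0 x - 2 * l * W 1 x + W 2 x\<close>.\<close>
  have "0 \<le> P x k * (l - t k)\<^sup>2"
    by (simp add: P_nonneg)
  then show "2 * l * (P x k * t k ^ 1) \<le> l\<^sup>2 * (P x k * t k ^ 0) + P x k * t k ^ 2"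
    by (simp add: power2_diff algebra_simps)
qed

lemma integrable_mass:
  fixes f :: "'a \<Rightarrow> real"
  shows "integrable (mass n) f \<longleftrightarrow> integrable (count_space S) (\<lambda>x. W n x * f x)"
    and "(\<integral>x. f x \<partial>mass n) = (\<integral>x. W n x * f x \<partial>count_space S)"
  by (simp_all add: mass_def point_measure_def integrable_density integral_density
      AE_count_space W_nonneg)

text \<open>The quadratic form of the inequality is linear in \<open>W\<close>, unlike
  \<open>(W 1 x)\<^sup>2 \<le> W 0 x * W 2 x\<close>, so it survives weighting by \<open>f x\<close>
  and summation over \<open>x\<close>.\<close>

lemma integral_quadratic:
  fixes f :: "'a \<Rightarrow> real"
  assumes "\<And>m. m \<le> 2 \<Longrightarrow> integrable (mass m) f" "\<And>x. 0 \<le> f x"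
  shows "2 * l * (\<integral>x. f x \<partial>mass 1) \<le> l\<^sup>2 * (\<integral>x. f x \<partial>mass 0) + (\<integral>x. f x \<partial>mass 2)"
proof -
  have int: "integrable (count_space S) (\<lambda>x. W m x * f x)" if "m \<le> 2" for m
    using assms(1)[OF that] by (simp add: integrable_mass)
  have "(\<integral>x. 2 * l * (W 1 x * f x) \<partial>count_space S)
      \<le> (\<integral>x. l\<^sup>2 * (W 0 x * f x) + W 2 x * f x \<partial>count_space S)"
  proof (intro integral_mono)
    fix x assume "x \<in> space (count_space S)"
    then have "2 * l * W 1 x * f x \<le> (l\<^sup>2 * W 0 x + W 2 x) * f x"
      by (intro mult_right_mono W_quadratic assms) auto
    then show "2 * l * (W 1 x * f x) \<le> l\<^sup>2 * (W 0 x * f x) + W 2 x * f x"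
      by (simp add: algebra_simps)
  qed (auto intro!: int)
  then show ?thesis
    by (simp add: integrable_mass(2) int)
qed

lemma paranormal: "paranormal H C"
  unfolding paranormal_def
proof
  fix F assume F: "F \<in> dom (op_power H C 2)"
  obtain f where f: "f \<in> sq_integrable M" "F = ae_class M f"
    using F dom_op_power_vecs by (blast elim: L2_cases)
  define I where "I n = (\<integral>x. (cmod (f x))\<^sup>2 \<partial>mass n)" for n
  have int: "integrable (mass m) (\<lambda>x. (cmod (f x))\<^sup>2)" if "m \<le> 2" for m
    using F f that by (simp add: dom_op_power_iff)
  have dom: "ae_class M f \<in> dom (op_power H C m)" if "m \<le> 2" for m
    using f int that by (simp add: dom_op_power_iff)
  have norms: "(vnorm H F)\<^sup>2 = I 0" "(vnorm H (the (C F)))\<^sup>2 = I 1"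
      "(vnorm H (the (op_power H C 2 F)))\<^sup>2 = I 2"
    using f vnorm_ae_class[OF f(1)] vnorm_op_power[OF f(1) dom[of 1], unfolded op_power_one] vnorm_op_power[OF f(1) dom[of 2]]
    by (simp_all add: I_def)
  \<comment> \<open>This is the square of the claimed inequality.\<close>
  have "(I 1)\<^sup>2 \<le> I 0 * I 2"
    unfolding I_def by (rule discriminant[OF integral_quadratic]) (auto intro: int)
  then have "((vnorm H (the (C F)))\<^sup>2)\<^sup>2 \<le> (vnorm H F * vnorm H (the (op_power H C 2 F)))\<^sup>2"
    by (simp add: norms power_mult_distrib)
  then show "(vnorm H (the (C F)))\<^sup>2 \<le> vnorm H F * vnorm H (the (op_power H C 2 F))"
    by (rule power2_le_imp_le) (simp add: vnorm_nonneg)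
qed

section \<open>Stieltjes moment sequences\<close>

lemma stieltjes:
  fixes f :: "'a \<Rightarrow> real"
  assumes int: "\<And>n. integrable (mass n) f" and f: "\<And>x. 0 \<le> f x"
  shows "stieltjes_moment_sequence (\<lambda>n. \<integral>x. f x \<partial>mass n)"
proof -
  \<comment> \<open>Superposing the measures of all points with weights \<open>f x\<close>
    contributes the mass \<open>q k\<close> at \<open>t k\<close>. The moments of the superposition
    follow by exchanging the nonnegative sums over \<open>x\<close> and \<open>k\<close>.\<close>
  define q where "q k = (\<integral>\<^sup>+x. ennreal (f x * P x k) \<partial>count_space S)" for k
  define \<nu> where "\<nu> = distr (point_measure UNIV q) (restrict_space borel {0::real..}) t"
  have t[measurable]: "t \<in> measurable (point_measure UNIV q) (restrict_space borel {0..})"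
    by (auto intro!: measurable_restrict_space2 simp: t_nonneg)
  have "has_bochner_integral \<nu> (\<lambda>x. x ^ n) (\<integral>x. f x \<partial>mass n)" for n
  proof (rule has_bochner_integral_nn_integral)
    show [measurable]: "(\<lambda>x. x ^ n) \<in> borel_measurable \<nu>"
      by (auto simp: \<nu>_def intro!: measurable_restrict_space1)
    show "AE x in \<nu>. 0 \<le> x ^ n"
      by (rule AE_I2) (auto simp: \<nu>_def space_restrict_space)
    show "0 \<le> (\<integral>x. f x \<partial>mass n)"
      by (simp add: f)
    have "(\<integral>\<^sup>+x. ennreal (x ^ n) \<partial>\<nu>) = (\<integral>\<^sup>+k. ennreal (t k ^ n) \<partial>point_measure UNIV q)"
      unfolding \<nu>_def by (subst nn_integral_distr) (auto intro!: measurable_restrict_space1 simp: t_nonneg)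
    also have "\<dots> = (\<integral>\<^sup>+k. q k * ennreal (t k ^ n) \<partial>count_space UNIV)"
      by (simp add: point_measure_def nn_integral_density)
    also have "\<dots> = (\<integral>\<^sup>+k. \<integral>\<^sup>+x. ennreal (f x * (P x k * t k ^ n)) \<partial>count_space S \<partial>count_space UNIV)"
      unfolding q_def
      by (auto simp: f P_nonneg t_nonneg ennreal_mult mult.assoc nn_integral_multc[symmetric]
          intro!: nn_integral_cong)
    also have "\<dots> = (\<integral>\<^sup>+x. \<integral>\<^sup>+k. ennreal (f x * (P x k * t k ^ n)) \<partial>count_space UNIV \<partial>count_space S)"
      using countable by (intro nn_integral_count_space_nn_integral[symmetric]) auto
    also have "\<dots> = (\<integral>\<^sup>+x. ennreal (W n x * f x) \<partial>count_space S)"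
    proof (intro nn_integral_cong)
      fix x assume "x \<in> space (count_space S)"
      then have "(\<lambda>k. f x * (P x k * t k ^ n)) sums (f x * W n x)"
        by (intro sums_mult W_sums) simp
      then show "(\<integral>\<^sup>+k. ennreal (f x * (P x k * t k ^ n)) \<partial>count_space UNIV) = ennreal (W n x * f x)"
        unfolding nn_integral_count_space_nat
        by (subst suminf_ennreal2) (auto simp: f P_nonneg t_nonneg sums_iff mult.commute)
    qed
    also have "\<dots> = ennreal (\<integral>x. W n x * f x \<partial>count_space S)"
      using int[of n] f by (intro nn_integral_eq_integral) (auto simp: integrable_mass AE_count_space W_nonneg)
    finally show "(\<integral>\<^sup>+x. ennreal (x ^ n) \<partial>\<nu>) = ennreal (\<integral>x. f x \<partial>mass n)"
      by (simp add: integrable_mass)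
  qed
  then show ?thesis
    unfolding stieltjes_moment_sequence_def by (intro exI[of _ \<nu>]) (simp add: \<nu>_def)
qed

lemma generates_stieltjes: "generates_stieltjes H C"
  unfolding generates_stieltjes_def
proof (intro conjI ballI dense_dom_infty)
  fix F assume F: "F \<in> dom_infty H C"
  obtain f where f: "f \<in> sq_integrable M" "F = ae_class M f"
    using F dom_infty_vecs by (blast elim: L2_cases)
  have "ae_class M f \<in> dom (op_power H C n)" for n
    using F f by (auto simp: dom_infty_def)
  then have "(\<lambda>n. (vnorm H (the (op_power H C n F)))\<^sup>2) = (\<lambda>n. \<integral>x. (cmod (f x))\<^sup>2 \<partial>mass n)"
    using f by (simp add: vnorm_op_power)
  moreover have "stieltjes_moment_sequence (\<lambda>n. \<integral>x. (cmod (f x))\<^sup>2 \<partial>mass n)"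
    using F f by (intro stieltjes) (auto simp: dom_infty_iff)
  ultimately show "stieltjes_moment_sequence (\<lambda>n. (vnorm H (the (op_power H C n F)))\<^sup>2)"
    by simp
qed

section \<open>The adjoint and hyponormality\<close>

lemma adjoint_pair_value:
  fixes f h :: "'a \<Rightarrow> complex"
  assumes pair: "adjoint_pair H C (ae_class M f) (ae_class M h)"
    and f: "f \<in> sq_integrable M" and h: "h \<in> sq_integrable M" and x: "x \<in> S"
  shows "W 0 x * h x = (\<integral>y. indicator {x} (\<phi> y) * f y \<partial>M)"
proof -
  \<comment> \<open>\<open>C\<close> takes the indicator of \<open>{x}\<close> to that of the fibre
    over \<open>x\<close>, so testing the adjoint relation on it isolates
    \<open>h x\<close>.\<close>
  define u :: "'a \<Rightarrow> complex" where "u = indicator {x}"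
  have u: "u \<in> sq_integrable M" "ae_class M u \<in> dom_infty H C"
    using x by (auto intro!: finite_support_in_dom_infty[of "{x}"] simp: u_def indicator_def)
  have u_dom: "ae_class M u \<in> dom C"
    by (rule dom_infty_dom_op[OF u(2)])
  then have u\<phi>: "u \<circ> \<phi> \<in> sq_integrable M"
    using u by (auto simp: composition_op_ae_class[OF nonsingular] split: if_splits)
  have "vinner H (the (C (ae_class M u))) (ae_class M f) = vinner H (ae_class M u) (ae_class M h)"
    using pair u_dom by (simp add: adjoint_pair_def)
  then have "(\<integral>y. u (\<phi> y) * cnj (f y) \<partial>M) = (\<integral>y. u y * cnj (h y) \<partial>M)"
    using u u\<phi> f h by (simp add: composition_op_ae_class[OF nonsingular] vinner_ae_class)
  also have "\<dots> = W 0 x * cnj (h x)"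
    using x by (subst integral_finite_support[of "{x}"]) (auto simp: u_def scaleR_conv_of_real)
  \<comment> \<open>The inner product conjugates its second argument; conjugating both sides frees
    \<open>f\<close> and \<open>h\<close>.\<close>
  finally have "cnj (W 0 x * cnj (h x)) = cnj (\<integral>y. u (\<phi> y) * cnj (f y) \<partial>M)"
    by (simp only:)
  also have "\<dots> = (\<integral>y. cnj (u (\<phi> y) * cnj (f y)) \<partial>M)"
    by (rule Bochner_Integration.integral_cnj[symmetric])
  also have "\<dots> = (\<integral>y. indicator {x} (\<phi> y) * f y \<partial>M)"
    by (intro Bochner_Integration.integral_cong) (auto simp: u_def split: split_indicator)
  finally show ?thesis
    by simp
qed

text \<open>\<open>adjoint_pair_value\<close> and \<open>W 0 x > 0\<close> fix the adjoint vector at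
  every point, so the \<open>THE\<close> in \<open>op_adjoint\<close> denotes it.\<close>

lemma op_adjoint_eq:
  assumes pair: "adjoint_pair H C F G"
  shows "op_adjoint H C F = Some G"
proof -
  have "F \<in> vecs H" "G \<in> vecs H"
    using pair by (auto simp: adjoint_pair_def)
  then obtain f g where f: "f \<in> sq_integrable M" "F = ae_class M f"
      and g: "g \<in> sq_integrable M" "G = ae_class M g"
    by (auto elim!: L2_cases)
  have "G' = G" if pair': "adjoint_pair H C F G'" for G'
  proof -
    have "G' \<in> vecs H"
      using pair' by (auto simp: adjoint_pair_def)
    then obtain h where h: "h \<in> sq_integrable M" "G' = ae_class M h"
      by (auto elim!: L2_cases)
    have "W 0 x * h x = W 0 x * g x" if "x \<in> S" for x
      using adjoint_pair_value[of f g] adjoint_pair_value[of f h] pair pair' f g h that by simp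
    then have "h x = g x" if "x \<in> S" for x
      using that W_pos[OF that] by fastforce
    then show ?thesis
      using g h by (simp add: ae_class_eq_iff)
  qed
  then have "(THE G. adjoint_pair H C F G) = G"
    by (rule the_equality[where P = "adjoint_pair H C F", OF pair])
  moreover have "\<exists>G. adjoint_pair H C F G"
    using pair by blast
  ultimately show ?thesis
    by (simp only: op_adjoint_def if_True)
qed

text \<open>Tested on the vector with values \<open>W 0 y / W 1 y\<close> on \<open>A\<close>, for which Cauchy--Schwarz is sharp.\<close>

lemma hyponormal_fibre_le:
  assumes hyp: "hyponormal H C" and x: "x \<in> S"
    and A: "finite A" "A \<subseteq> {y\<in>S. \<phi> y = x}"
  shows "(\<Sum>y\<in>A. (W 0 y)\<^sup>2 / W 1 y) \<le> W 0 x"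
proof -
  define r where "r y = (if y \<in> A then W 0 y / W 1 y else 0)" for y
  define f where "f y = complex_of_real (r y)" for y
  define s where "s = (\<Sum>y\<in>A. (W 0 y)\<^sup>2 / W 1 y)"
  have s_nonneg: "0 \<le> s"
    unfolding s_def using A W_nonneg by (intro sum_nonneg) auto
  have f: "f \<in> sq_integrable M" "ae_class M f \<in> dom_infty H C"
    using A by (auto intro!: finite_support_in_dom_infty[of A] simp: f_def r_def)
  have f_dom: "ae_class M f \<in> dom C"
    by (rule dom_infty_dom_op[OF f(2)])
  have norm_Cf: "(vnorm H (the (C (ae_class M f))))\<^sup>2 = (\<integral>y. (cmod (f y))\<^sup>2 \<partial>mass 1)"
    using vnorm_op_power[OF f(1) dom_infty_dom[OF f(2)], of 1] by (simp only: op_power_one)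
  have "(\<integral>y. (cmod (f y))\<^sup>2 \<partial>mass 1) = (\<Sum>y\<in>A. W 1 y *\<^sub>R (cmod (f y))\<^sup>2)"
    using A by (intro integral_finite_support) (auto simp: f_def r_def)
  also have "\<dots> = s"
    unfolding s_def by (intro sum.cong) (auto simp: f_def r_def power2_eq_square norm_divide)
  finally have norm_Cf_eq: "(vnorm H (the (C (ae_class M f))))\<^sup>2 = s"
    using norm_Cf by simp
  obtain G where G: "adjoint_pair H C (ae_class M f) G"
  proof -
    have "ae_class M f \<in> dom (op_adjoint H C)"
      using hyp f_dom unfolding hyponormal_def by blast
    then have "\<exists>G. adjoint_pair H C (ae_class M f) G"
      unfolding domIff op_adjoint_def by (rule contrapos_np) (simp only: if_False)
    then show ?thesis
      using that by blast
  qed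
  then have "G \<in> vecs H"
    by (simp add: adjoint_pair_def)
  then obtain h where h: "h \<in> sq_integrable M" "G = ae_class M h"
    by (elim L2_cases)
  have "vnorm H (the (op_adjoint H C (ae_class M f))) \<le> vnorm H (the (C (ae_class M f)))"
    using hyp f_dom by (simp add: hyponormal_def)
  then have "(vnorm H G)\<^sup>2 \<le> (vnorm H (the (C (ae_class M f))))\<^sup>2"
    by (intro power_mono) (simp_all add: op_adjoint_eq[OF G] vnorm_nonneg)
  then have norm_G: "(\<integral>y. (cmod (h y))\<^sup>2 \<partial>M) \<le> s"
    using norm_Cf_eq h by (simp add: vnorm_ae_class)
  have "W 0 x * h x = (\<integral>y. indicator {x} (\<phi> y) * f y \<partial>M)"
    using G f h x by (intro adjoint_pair_value) auto
  also have "\<dots> = (\<Sum>y\<in>A. W 0 y *\<^sub>R (indicator {x} (\<phi> y) * f y))"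
    using A by (intro integral_finite_support) (auto simp: f_def r_def)
  also have "\<dots> = (\<Sum>y\<in>A. complex_of_real ((W 0 y)\<^sup>2 / W 1 y))"
    using A by (intro sum.cong) (auto simp: f_def r_def power2_eq_square scaleR_conv_of_real)
  finally have h_x: "W 0 x * h x = complex_of_real s"
    by (simp add: s_def)
  \<comment> \<open>Keeping only the point \<open>x\<close> in the squared norm of \<open>G\<close>,
    which is at most \<open>s\<close>, and inserting \<open>W 0 x * h x = s\<close> yields
    \<open>s * s \<le> W 0 x * s\<close>.\<close>
  have "(cmod (h x))\<^sup>2 * W 0 x = (\<integral>y. (cmod (h x))\<^sup>2 * indicator {x} y \<partial>M)"
    using x by (subst integral_finite_support[of "{x}"]) auto
  also have "\<dots> \<le> (\<integral>y. (cmod (h y))\<^sup>2 \<partial>M)"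
    using h x by (intro integral_mono)
      (auto simp: sq_integrable_def indicator_def intro!: integral_finite_support(1)[of "{x}"])
  finally have "W 0 x * (W 0 x * (cmod (h x))\<^sup>2) \<le> W 0 x * s"
    using norm_G W_pos[OF x] by (intro mult_left_mono) (auto simp: mult.commute)
  also have "W 0 x * (W 0 x * (cmod (h x))\<^sup>2) = (cmod (W 0 x * h x))\<^sup>2"
    by (simp add: norm_mult power2_eq_square)
  also have "\<dots> = s * s"
    by (simp add: h_x power2_eq_square)
  finally have "s * s \<le> W 0 x * s" .
  then show ?thesis
    using s_nonneg W_pos[OF x] mult_right_le_imp_le[of s s "W 0 x"]
    unfolding s_def[symmetric] by (cases "s = 0") auto
qed

end

section \<open>A pair of Stieltjes measures with the same moments\<close>

primrec coef :: "nat \<Rightarrow> real" where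
  "coef 0 = 1"
| "coef (Suc n) = coef n / (2 ^ Suc n - 1)"

lemma coef_pos: "0 < coef n"
proof (induction n)
  case (Suc n)
  have "(1::real) < 2 ^ Suc n"
    by (rule one_less_power) auto
  with Suc show ?case
    by simp
qed simp

lemma summable_coef: "summable (\<lambda>n. coef n * z ^ n)"
proof -
  \<comment> \<open>From index \<open>N\<close> on, \<open>2 ^ Suc n - 1\<close> exceeds
    \<open>2 * \<bar>z\<bar>\<close>, so the ratio of successive terms is at most
    \<open>1 / 2\<close>.\<close>
  obtain N where N: "2 * \<bar>z\<bar> + 1 < 2 ^ N"
    using real_arch_pow[of 2 "2 * \<bar>z\<bar> + 1"] by auto
  show ?thesis
  proof (rule summable_ratio_test[of "1/2" N])
    fix n assume n: "N \<le> n"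
    have "(2::real) ^ N \<le> 2 ^ Suc n"
      using n by (intro power_increasing) auto
    with N have "\<bar>z\<bar> / (2 ^ Suc n - 1) \<le> 1 / 2"
      by (simp add: field_simps)
    then have "\<bar>z\<bar> / (2 ^ Suc n - 1) * (coef n * \<bar>z\<bar> ^ n) \<le> 1 / 2 * (coef n * \<bar>z\<bar> ^ n)"
      using coef_pos[of n] by (intro mult_right_mono) auto
    moreover have "norm (coef (Suc n) * z ^ Suc n) = \<bar>z\<bar> / (2 ^ Suc n - 1) * (coef n * \<bar>z\<bar> ^ n)"
      using coef_pos[of n] one_le_power[of "2::real" "Suc n"]
      by (simp add: abs_mult power_abs abs_divide del: power_Suc) (simp add: field_simps)
    moreover have "norm (coef n * z ^ n) = coef n * \<bar>z\<bar> ^ n"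
      using coef_pos[of n] by (simp add: abs_mult power_abs)
    ultimately show "norm (coef (Suc n) * z ^ Suc n) \<le> 1/2 * norm (coef n * z ^ n)"
      by simp
  qed simp
qed

text \<open>Euler's product \<open>\<Prod>j\<ge>1. 1 + z / 2 ^ j\<close>, with zeros exactly at \<open>- 2 ^ j\<close>.\<close>

definition euler_fun :: "real \<Rightarrow> real" where
  "euler_fun z = (\<Sum>n. coef n * z ^ n)"

text \<open>By the recursion for \<open>coef\<close>, the difference of the series at
  \<open>2 * z\<close> and \<open>z\<close> is the series at \<open>z\<close> shifted by one
  degree.\<close>

lemma euler_fun_double: "euler_fun (2 * z) = (1 + z) * euler_fun z"
proof -
  have shift: "coef (Suc n) * (2 * z) ^ Suc n - coef (Suc n) * z ^ Suc n = z * (coef n * z ^ n)" for n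
  proof -
    have "coef (Suc n) * (2 * z) ^ Suc n - coef (Suc n) * z ^ Suc n
        = coef (Suc n) * (2 ^ Suc n - 1) * z ^ Suc n"
      by (simp only: power_mult_distrib algebra_simps)
    also have "coef (Suc n) * (2 ^ Suc n - 1) = coef n"
    proof -
      have "(2::real) ^ Suc n \<noteq> 1"
        using one_less_power[of "2::real" "Suc n"] by linarith
      then show ?thesis
        by (simp del: power_Suc)
    qed
    finally show ?thesis
      by simp
  qed
  have "euler_fun (2 * z) - euler_fun z = (\<Sum>n. coef n * (2 * z) ^ n - coef n * z ^ n)"
    unfolding euler_fun_def by (intro suminf_diff summable_coef)
  \<comment> \<open>The constant terms cancel, so the sum starts at degree 1.\<close>
  also have "\<dots> = (\<Sum>n. coef (Suc n) * (2 * z) ^ Suc n - coef (Suc n) * z ^ Suc n)"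
    by (subst suminf_split_head) (rule summable_diff[OF summable_coef summable_coef], simp)
  also have "\<dots> = (\<Sum>n. z * (coef n * z ^ n))"
    by (simp only: shift)
  also have "\<dots> = z * euler_fun z"
    unfolding euler_fun_def by (intro suminf_mult summable_coef)
  finally show ?thesis
    by (simp add: algebra_simps)
qed

text \<open>The factor \<open>1 + z\<close> at \<open>z = -1\<close> produces the zero
  \<open>-2\<close>, and the double of a zero is again a zero.\<close>

lemma euler_fun_zero: "euler_fun (- (2 ^ Suc n)) = 0"
proof (induction n)
  case 0
  show ?case
    using euler_fun_double[of "-1"] by simp
next
  case (Suc n)
  then show ?case
    using euler_fun_double[of "- (2 ^ Suc n)"] by simp
qed

text \<open>At \<open>z = 2 ^ n\<close> this is the \<open>n\<close>-th moment of the measure with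
  atoms \<open>coef k\<close> at \<open>2 ^ k\<close> for \<open>k\<close> in \<open>Q\<close>,
  because \<open>(2 ^ n) ^ k = (2 ^ k) ^ n\<close>.\<close>

definition part_sum :: "(nat \<Rightarrow> bool) \<Rightarrow> real \<Rightarrow> real" where
  "part_sum Q z = (\<Sum>k. if Q k then coef k * z ^ k else 0)"

lemma part_sums:
  assumes "0 \<le> z"
  shows "(\<lambda>k. if Q k then coef k * z ^ k else 0) sums part_sum Q z"
proof -
  have "summable (\<lambda>k. if Q k then coef k * z ^ k else 0)"
    by (rule summable_comparison_test'[OF summable_coef[of z], of 0])
      (use coef_pos assms in \<open>auto simp: less_imp_le\<close>)
  then show ?thesis
    by (simp add: part_sum_def summable_sums)
qed

text \<open>The difference of the two parts at \<open>z\<close> is \<open>euler_fun (- z)\<close>,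
  and \<open>- (2 ^ Suc n)\<close> is a zero.\<close>

lemma even_part_eq_odd_part: "part_sum even (2 ^ Suc n) = part_sum odd (2 ^ Suc n)"
proof -
  define z :: real where "z = 2 ^ Suc n"
  have "(\<lambda>k. (if even k then coef k * z ^ k else 0) - (if odd k then coef k * z ^ k else 0))
      sums (part_sum even z - part_sum odd z)"
    by (intro sums_diff part_sums) (simp_all add: z_def)
  also have "(\<lambda>k. (if even k then coef k * z ^ k else 0) - (if odd k then coef k * z ^ k else 0))
      = (\<lambda>k. coef k * (- z) ^ k)"
    by (auto simp: fun_eq_iff)
  finally have "part_sum even z - part_sum odd z = euler_fun (- z)"
    unfolding euler_fun_def by (rule sums_unique)
  then show ?thesis
    using euler_fun_zero[of n] by (simp add: z_def)
qed

lemma part_sum_single: "part_sum (\<lambda>k. k = i) z = coef i * z ^ i"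
  unfolding part_sum_def using sums_single[of i "\<lambda>k. coef k * z ^ k"] by (simp add: sums_iff)

text \<open>Here \<open>coef 3 = 1 / (1 * 3 * 7)\<close>, and each later factor is at most
  \<open>1 / 2\<close>.\<close>

lemma coef_tail: "coef (k + 3) \<le> 1 / 21 * (1 / 2) ^ k"
proof (induction k)
  case 0
  show ?case
    by (simp add: numeral_3_eq_3)
next
  case (Suc k)
  have "(2::real) ^ 2 \<le> 2 ^ Suc (k + 3)"
    by (intro power_increasing) auto
  then have "coef (k + 3) / (2 ^ Suc (k + 3) - 1) \<le> coef (k + 3) / 2"
    using coef_pos[of "k + 3"] by (intro divide_left_mono mult_pos_pos) (auto simp del: power_Suc)
  then have "coef (Suc k + 3) \<le> coef (k + 3) / 2"
    by (simp only: add_Suc coef.simps)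
  with Suc show ?case
    by simp
qed

text \<open>The bound is \<open>coef 0 + coef 2\<close>, the contribution of two branches. The odd
  part is \<open>coef 1 = 1\<close> plus a tail of at most \<open>2 / 21\<close>.\<close>

lemma part_sum_odd_1_less: "part_sum odd 1 < 4 / 3"
proof -
  define u where "u k = (if odd k then coef k else 0)" for k
  have u: "u sums part_sum odd 1"
    using part_sums[of 1 odd] unfolding u_def by (simp only: power_one mult_1_right zero_le_one)
  have geometric: "(\<lambda>k. 1 / 21 * (1 / 2) ^ k) sums (1 / 21 * (1 / (1 - 1 / 2 :: real)))"
    by (intro sums_mult geometric_sums) simp
  have "(\<lambda>k. u (k + 3)) sums (part_sum odd 1 - (\<Sum>k<3. u k))"
    by (rule sums_split_initial_segment[OF u])
  then have "part_sum odd 1 - (\<Sum>k<3. u k) \<le> 1 / 21 * (1 / (1 - 1 / 2))"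
    by (rule sums_le[rotated, OF _ geometric]) (use coef_tail in \<open>auto simp: u_def\<close>)
  moreover have "(\<Sum>k<3. u k) = 1"
    by (simp add: u_def numeral_3_eq_3)
  ultimately show ?thesis
    by simp
qed

section \<open>The tree\<close>

text \<open>Levels \<open>j \<le> 0\<close> form a trunk; above it one branch grows for each even \<open>i\<close>. Branches
  carry the atoms of the even part and the trunk carries the moments of the odd part. Vertices are
  encoded as real numbers through \<open>to_nat\<close>.\<close>

definition node :: "int \<Rightarrow> nat \<Rightarrow> real" where
  "node j i = real (to_nat (j, i))"

definition level :: "real \<Rightarrow> int" where
  "level x = fst (from_nat (nat \<lfloor>x\<rfloor>) :: int \<times> nat)"

definition branch :: "real \<Rightarrow> nat" where
  "branch x = snd (from_nat (nat \<lfloor>x\<rfloor>) :: int \<times> nat)"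

lemma level_node [simp]: "level (node j i) = j"
  and branch_node [simp]: "branch (node j i) = i"
  by (simp_all add: node_def level_def branch_def)

lemma node_eq_iff [simp]: "node j i = node j' i' \<longleftrightarrow> j = j' \<and> i = i'"
  by (simp add: node_def)

definition tree :: "real set" where
  "tree = {node j i | j i. if j \<le> 0 then i = 0 else even i}"

text \<open>All of level 1 goes to \<open>node 0 0\<close>, the only branching vertex. The trunk is
  endless downwards and the branches upwards, so the map sends \<open>tree\<close> onto
  itself.\<close>

definition parent :: "real \<Rightarrow> real" where
  "parent x = node (level x - 1) (if level x \<le> 1 then 0 else branch x)"

definition supp :: "real \<Rightarrow> nat \<Rightarrow> bool" where
  "supp x k \<longleftrightarrow> (if level x \<le> 0 then odd k else k = branch x)"

text \<open>The factor \<open>(2 ^ k) powi level x\<close> shifts the order of moments by the level,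
  so passing to a child on the same trunk or branch raises the order by one.\<close>

definition atom :: "real \<Rightarrow> nat \<Rightarrow> real" where
  "atom x k = (if supp x k then coef k * (2 powi level x) ^ k else 0)"

definition weight :: "nat \<Rightarrow> real \<Rightarrow> real" where
  "weight n x = part_sum (supp x) (2 powi (level x + int n))"

lemma node_in_tree: "node j i \<in> tree \<longleftrightarrow> (if j \<le> 0 then i = 0 else even i)"
  by (auto simp: tree_def)

lemma tree_cases:
  assumes "x \<in> tree"
  obtains j i where "x = node j i" "if j \<le> 0 then i = 0 else even i"
  using assms by (auto simp: tree_def)

lemma countable_tree: "countable tree"
  by (rule countable_subset[of _ "(\<lambda>(j, i). node j i) ` UNIV"]) (auto simp: tree_def)

lemma parent_image: "parent ` tree = tree"
proof (intro equalityI subsetI)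
  fix y assume "y \<in> parent ` tree"
  then show "y \<in> tree"
    by (auto simp: parent_def node_in_tree elim!: tree_cases split: if_splits)
next
  fix x assume "x \<in> tree"
  then obtain j i where x: "x = node j i" "if j \<le> 0 then i = 0 else even i"
    by (rule tree_cases)
  then have "node (j + 1) i \<in> tree" "parent (node (j + 1) i) = x"
    by (auto simp: node_in_tree parent_def split: if_splits)
  then show "x \<in> parent ` tree"
    by (metis imageI)
qed

section \<open>Weights and fibres of the tree\<close>

lemma weight_trunk: "j \<le> 0 \<Longrightarrow> weight n (node j i) = part_sum odd (2 powi (j + int n))"
  by (simp add: weight_def supp_def[abs_def])

lemma weight_branch: "0 < j \<Longrightarrow> weight n (node j i) = coef i * (2 powi (j + int n)) ^ i"
  by (simp add: weight_def supp_def[abs_def] part_sum_single)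

lemma weight_sums: "(\<lambda>k. atom x k * (2 ^ k) ^ n) sums weight n x"
proof -
  have "(2 powi level x) ^ k * (2 ^ k) ^ n = (2 powi (level x + int n) :: real) ^ k" for k
    by (simp add: power_int_add power_mult_distrib mult.commute flip: power_mult)
  then have "(\<lambda>k. atom x k * (2 ^ k) ^ n)
      = (\<lambda>k. if supp x k then coef k * (2 powi (level x + int n)) ^ k else 0)"
    by (auto simp: atom_def fun_eq_iff mult.assoc)
  then show ?thesis
    unfolding weight_def by (simp add: part_sums)
qed

lemma part_sum_odd_pos:
  assumes "0 < z"
  shows "0 < part_sum odd z"
proof -
  have "coef 1 * z ^ 1 \<le> part_sum odd z"
    using sum_le_suminf[OF sums_summable[OF part_sums[of z odd]], of "{1}"] assms coef_pos
    by (simp add: part_sum_def less_imp_le)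
  then show ?thesis
    using assms by simp
qed

lemma weight_pos: "0 < weight n (node j i)"
  by (cases "j \<le> 0") (simp_all add: weight_trunk weight_branch part_sum_odd_pos coef_pos)

text \<open>Away from level 0 the fibre is a single vertex with the same support, and only the order
  shifts. At \<open>node 0 0\<close> the branches add up to the even part at
  \<open>2 ^ Suc n\<close>; its order is at least 1, so it equals the odd part carried by the
  trunk.\<close>

lemma weight_fibre:
  assumes "x \<in> tree"
  shows "(\<integral>\<^sup>+y. ennreal (weight n y) \<partial>count_space {y\<in>tree. parent y = x})
    = ennreal (weight (Suc n) x)"
proof -
  obtain j i where x: "x = node j i" "if j \<le> 0 then i = 0 else even i"
    using assms by (rule tree_cases)
  show ?thesis
  proof (cases "j = 0")
    case False
    have "{y\<in>tree. parent y = x} = {node (j + 1) i}"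
      using x False
      by (auto simp: parent_def node_in_tree elim!: tree_cases split: if_splits)
    moreover have "weight n (node (j + 1) i) = weight (Suc n) x"
    proof (cases "j < 0")
      case True
      then show ?thesis
        using x by (simp add: weight_trunk ac_simps)
    next
      case False
      then show ?thesis
        using x \<open>j \<noteq> 0\<close> by (simp add: weight_branch ac_simps)
    qed
    ultimately show ?thesis
      by (simp add: nn_integral_count_space_finite)
  next
    case True
    have two_powi: "2 powi (1 + int n) = (2 ^ Suc n :: real)"
      by (simp add: power_int_add)
    have "{y\<in>tree. parent y = x} = node 1 ` {i. even i}"
      using x True by (auto simp: parent_def node_in_tree elim!: tree_cases split: if_splits)
    then have "bij_betw (node 1) {i. even i} {y\<in>tree. parent y = x}"
      by (auto simp: bij_betw_def inj_on_def)
    then have "(\<integral>\<^sup>+y. ennreal (weight n y) \<partial>count_space {y\<in>tree. parent y = x})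
        = (\<integral>\<^sup>+i. ennreal (weight n (node 1 i)) \<partial>count_space {i. even i})"
      by (rule nn_integral_bij_count_space[symmetric])
    also have "\<dots> = (\<integral>\<^sup>+i. ennreal (if even i then coef i * (2 ^ Suc n) ^ i else 0) \<partial>count_space UNIV)"
      by (subst nn_integral_count_space_indicator)
        (auto simp: weight_branch two_powi simp del: power_Suc intro!: nn_integral_cong)
    also have "\<dots> = ennreal (part_sum even (2 ^ Suc n))"
      using part_sums[of "2 ^ Suc n" even] coef_pos
      by (simp add: nn_integral_count_space_nat suminf_ennreal2 less_imp_le sums_iff del: power_Suc)
    also have "\<dots> = ennreal (weight (Suc n) x)"
      using x True two_powi by (simp add: even_part_eq_odd_part weight_trunk del: power_Suc)
    finally show ?thesis .
  qed
qed

interpretation tree: discrete_composition tree parent "\<lambda>k. 2 ^ k" atom weight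
proof
  show "0 \<le> atom x k" for x k
    using coef_pos[of k] by (simp add: atom_def)
  show "x \<in> tree \<Longrightarrow> 0 < weight 0 x" for x
    by (auto simp: weight_pos elim: tree_cases)
qed (simp_all add: countable_tree parent_image weight_sums weight_fibre)

text \<open>Branch \<open>i\<close> contributes
  \<open>(coef i * 2 ^ i)\<^sup>2 / (coef i * 4 ^ i) = coef i\<close> to the fibre sum, so branches
  0 and 2 already exceed the weight of \<open>node 0 0\<close>.\<close>

lemma not_hyponormal: "\<not> hyponormal tree.H tree.C"
proof
  assume "hyponormal tree.H tree.C"
  then have "(\<Sum>y\<in>{node 1 0, node 1 2}. (weight 0 y)\<^sup>2 / weight 1 y) \<le> weight 0 (node 0 0)"
    by (rule tree.hyponormal_fibre_le) (auto simp: node_in_tree parent_def)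
  moreover have "(weight 0 (node 1 i))\<^sup>2 / weight 1 (node 1 i) = coef i" for i
    using coef_pos[of i]
    by (simp add: weight_branch power2_eq_square power_mult_distrib[symmetric] field_simps)
  moreover have "coef 2 = 1 / 3"
    by (simp add: numeral_2_eq_2)
  ultimately have "4 / 3 \<le> part_sum odd 1"
    by (simp add: weight_trunk)
  then show False
    using part_sum_odd_1_less by simp
qed

theorem theorem4p3p3:
  "\<exists>(M :: real measure) \<phi>. sigma_finite_measure M \<and> nonsingular M \<phi> \<and>
     (let H = L2 M; C = composition_op M \<phi> in
        \<not> hyponormal H C \<and>
        inj_on C (dom C) \<and>
        paranormal H C \<and>
        generates_stieltjes H C \<and>
        (\<forall>n. is_core H (dom_infty H C) (op_power H C n)))"
  unfolding Let_def
  using tree.sigma_finite tree.nonsingular not_hyponormal tree.injective tree.paranormal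
    tree.generates_stieltjes tree.is_core_dom_infty
  by blast

end
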